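(* Let $n\ge 2$ and let $L \subset \mathbb{R}^n$ be a lattice of rank $n$. The set of indecomposable elements of the semigroup $L^+$ is precisely the Hilbert basis for $L^+$. This set is finite if $L$ is a PVR lattice and infinite otherwise.
   Context: $L^+ = L \cap \mathbb{R}^n_{\ge 0} = \{x \in L : x_i \ge 0 \text{ for all } i\}$, a semigroup under addition (containing $0$). A nonzero vector $x \in L^+$ is indecomposable if there do not exist nonzero $y,z \in L^+$ with $x = y+z$. The Hilbert basis of such a semigroup is its unique minimal generating set, where generating means that every element is a nonnegative integer linear combination of finitely many elements of the set. A lattice of rank $n$ in $\mathbb{R}^n$ is positive rectangular (PR) if it has a basis consisting of pairwise orthogonal vectors with nonnegative coordinates; $L$ is positive virtually rectangular (PVR) if it contains a PR sublattice of finite index. *)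

theory Defs
  imports "HOL-Analysis.Analysis"
begin

definition int_span :: "'a::real_vector set \<Rightarrow> 'a set" where
  "int_span B = {(\<Sum>b\<in>F. of_int (c b) *\<^sub>R b) | F (c :: 'a \<Rightarrow> int). finite F \<and> F \<subseteq> B}"

definition lattice_basis :: "'a::real_vector set \<Rightarrow> 'a set \<Rightarrow> bool" where
  "lattice_basis B L \<longleftrightarrow> independent B \<and> L = int_span B"

text \<open>
  Finiteness of the basis is stated explicitly because the cardinality of an infinite set is 0.
\<close>

definition lattice_of_rank :: "nat \<Rightarrow> 'a::real_vector set \<Rightarrow> bool" where
  "lattice_of_rank r L \<longleftrightarrow> (\<exists>B. lattice_basis B L \<and> finite B \<and> card B = r)"

definition finite_index :: "'a::ab_group_add set \<Rightarrow> 'a set \<Rightarrow> bool" where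
  "finite_index M L \<longleftrightarrow> M \<subseteq> L \<and> finite ((\<lambda>x. (+) x ` M) ` L)"

definition nonneg_part :: "(real^'n) set \<Rightarrow> (real^'n) set" where
  "nonneg_part L = {x \<in> L. \<forall>i. 0 \<le> x $ i}"

definition positive_rectangular :: "(real^'n) set \<Rightarrow> bool" where
  "positive_rectangular L \<longleftrightarrow> lattice_of_rank CARD('n) L \<and>
     (\<exists>B. lattice_basis B L \<and> pairwise orthogonal B \<and> (\<forall>b\<in>B. \<forall>i. 0 \<le> b $ i))"

definition positive_virtually_rectangular :: "(real^'n) set \<Rightarrow> bool" where
  "positive_virtually_rectangular L \<longleftrightarrow>
     (\<exists>M. positive_rectangular M \<and> finite_index M L)"

definition indecomposables :: "'a::comm_monoid_add set \<Rightarrow> 'a set" where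
  "indecomposables S =
     {x \<in> S. x \<noteq> 0 \<and> \<not> (\<exists>y\<in>S. \<exists>z\<in>S. y \<noteq> 0 \<and> z \<noteq> 0 \<and> x = y + z)}"

text \<open>
  The empty combination is allowed, so 0 is generated by every set.
\<close>

definition generates_semigroup :: "'a::real_vector set \<Rightarrow> 'a set \<Rightarrow> bool" where
  "generates_semigroup G S \<longleftrightarrow> G \<subseteq> S \<and>
     (\<forall>x\<in>S. \<exists>F (c :: 'a \<Rightarrow> nat). finite F \<and> F \<subseteq> G \<and> x = (\<Sum>v\<in>F. of_nat (c v) *\<^sub>R v))"

definition minimal_generating_set :: "'a::real_vector set \<Rightarrow> 'a set \<Rightarrow> bool" where
  "minimal_generating_set G S \<longleftrightarrow>
     generates_semigroup G S \<and> (\<forall>G'. G' \<subset> G \<longrightarrow> \<not> generates_semigroup G' S)"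

text \<open>
  \<open>H\<close> is the Hilbert basis of \<open>S\<close>: it is a minimal generating set and the only one.
  The predicate thus includes existence and uniqueness.
\<close>

definition hilbert_basis :: "'a::real_vector set \<Rightarrow> 'a set \<Rightarrow> bool" where
  "hilbert_basis H S \<longleftrightarrow>
     minimal_generating_set H S \<and> (\<forall>G. minimal_generating_set G S \<longrightarrow> G = H)"

end

theory Submission imports Defs begin

text \<open>
  The semigroup \<open>nonneg_part L\<close> is pointed, and each of its elements has only finitely many
  summands, because the summands of \<open>x\<close> lie in the box between \<open>0\<close> and \<open>x\<close> and a lattice meets a
  bounded set in a finite set. Splitting an element repeatedly therefore stops, so the
  indecomposables generate (\<open>indecomposables_generate\<close>). An indecomposable cannot be written
  as a combination of other elements, so it belongs to every generating set
  (\<open>indecomposables_subset_generating\<close>). These two facts make the indecomposables the unique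
  minimal generating set.

  For the finiteness part, everything goes through one criterion: whether \<open>L\<close> contains a positive
  multiple of each coordinate vector. Nonnegative orthogonal vectors have disjoint supports, so an
  orthogonal nonnegative basis of the space consists of multiples of coordinate vectors; conversely,
  multiples of all the coordinate vectors span a positive rectangular sublattice, which has finite
  index because each coset meets a bounded box. Hence the criterion is equivalent to \<open>L\<close> being
  positive virtually rectangular.

  If the criterion holds, with multiples \<open>t i\<close>, then \<open>axis i (t i)\<close> splits off from every element
  of the semigroup whose \<open>i\<close>-th coordinate exceeds \<open>t i\<close>, so the indecomposables lie in a bounded
  box and are finite in number. If there are finitely many indecomposables and none is a multiple of the
  \<open>i\<close>-th coordinate vector, then on each of them, and hence on the whole semigroup, the
  \<open>i\<close>-th coordinate is at most a constant times the sum of the other coordinates. This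
  contradicts the fact that every ball of a certain fixed radius contains a lattice point: far out
  along the \<open>i\<close>-th axis there are nonnegative lattice points whose other coordinates stay
  bounded.
\<close>

section \<open>Indecomposables and generating sets\<close>

lemma sum_in_additive_closed:
  assumes "0 \<in> S" "\<And>x y. x \<in> S \<Longrightarrow> y \<in> S \<Longrightarrow> x + y \<in> S"
    and "\<And>a. a \<in> A \<Longrightarrow> f a \<in> S"
  shows "sum f A \<in> S"
  using assms(3) by (induction A rule: infinite_finite_induct) (simp_all add: assms(1,2))

lemma of_nat_scaleR_in_additive_closed:
  fixes v :: "'a::real_vector"
  assumes "0 \<in> S" "\<And>x y. x \<in> S \<Longrightarrow> y \<in> S \<Longrightarrow> x + y \<in> S" and "v \<in> S"
  shows "of_nat k *\<^sub>R v \<in> S"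
  by (induction k) (simp_all add: scaleR_add_left assms)

text \<open>
  One of the terms of a combination that represents an indecomposable \<open>x\<close> is nonzero. Splitting off
  a single copy of its generator leaves an element of the semigroup, which has to vanish; so \<open>x\<close>
  is that generator.
\<close>

lemma indecomposables_subset_generating:
  fixes S :: "'a::real_vector set"
  assumes zero: "0 \<in> S" and add: "\<And>x y. x \<in> S \<Longrightarrow> y \<in> S \<Longrightarrow> x + y \<in> S"
    and gen: "generates_semigroup G S"
  shows "indecomposables S \<subseteq> G"
proof
  fix x assume x: "x \<in> indecomposables S"
  then have "x \<in> S" "x \<noteq> 0"
    and indec: "\<And>y z. y \<in> S \<Longrightarrow> z \<in> S \<Longrightarrow> x = y + z \<Longrightarrow> y = 0 \<or> z = 0"
    unfolding indecomposables_def by blast+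
  with gen obtain F and c :: "'a \<Rightarrow> nat" where F: "finite F" "F \<subseteq> G" "G \<subseteq> S"
    and xsum: "x = (\<Sum>v\<in>F. of_nat (c v) *\<^sub>R v)"
    unfolding generates_semigroup_def by blast
  obtain v where v: "v \<in> F" "of_nat (c v) *\<^sub>R v \<noteq> 0"
    using \<open>x \<noteq> 0\<close> xsum by (metis (no_types, lifting) sum.neutral)
  then obtain k where k: "c v = Suc k" and "v \<noteq> 0"
    by (cases "c v") auto
  define rest where "rest = of_nat k *\<^sub>R v + (\<Sum>v\<in>F - {v}. of_nat (c v) *\<^sub>R v)"
  have split: "x = v + rest"
    unfolding xsum rest_def using F v by (simp add: sum.remove k scaleR_add_left)
  have "rest \<in> S"
    unfolding rest_def using F v
    by (intro add sum_in_additive_closed of_nat_scaleR_in_additive_closed zero) auto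
  then have "rest = 0"
    using indec[OF _ _ split] F v \<open>v \<noteq> 0\<close> by blast
  then show "x \<in> G"
    using split F v by auto
qed

lemma nat_combination_add:
  fixes G :: "'a::real_vector set"
  assumes "\<exists>F (c :: 'a \<Rightarrow> nat). finite F \<and> F \<subseteq> G \<and> x = (\<Sum>v\<in>F. of_nat (c v) *\<^sub>R v)"
    and "\<exists>F (c :: 'a \<Rightarrow> nat). finite F \<and> F \<subseteq> G \<and> y = (\<Sum>v\<in>F. of_nat (c v) *\<^sub>R v)"
  shows "\<exists>F (c :: 'a \<Rightarrow> nat). finite F \<and> F \<subseteq> G \<and> x + y = (\<Sum>v\<in>F. of_nat (c v) *\<^sub>R v)"
proof -
  obtain F and c :: "'a \<Rightarrow> nat"
    where F: "finite F" "F \<subseteq> G" "x = (\<Sum>v\<in>F. of_nat (c v) *\<^sub>R v)"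
    using assms(1) by blast
  obtain E and d :: "'a \<Rightarrow> nat"
    where E: "finite E" "E \<subseteq> G" "y = (\<Sum>v\<in>E. of_nat (d v) *\<^sub>R v)"
    using assms(2) by blast
  define e where "e v = (if v \<in> F then c v else 0) + (if v \<in> E then d v else 0)" for v
  have "x = (\<Sum>v\<in>F \<union> E. of_nat (if v \<in> F then c v else 0) *\<^sub>R v)"
    unfolding F(3) using F(1) E(1) by (intro sum.mono_neutral_cong_left) auto
  moreover have "y = (\<Sum>v\<in>F \<union> E. of_nat (if v \<in> E then d v else 0) *\<^sub>R v)"
    unfolding E(3) using F(1) E(1) by (intro sum.mono_neutral_cong_left) auto
  ultimately have "x + y = (\<Sum>v\<in>F \<union> E. of_nat (e v) *\<^sub>R v)"
    by (simp add: e_def scaleR_add_left sum.distrib)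
  then show ?thesis
    using F E by (intro exI[of _ "F \<union> E"] exI[of _ e]) auto
qed

text \<open>
  Induction on the number of summands of \<open>x\<close>. If \<open>x = y + z\<close> with \<open>z\<close> nonzero, then every summand
  of \<open>y\<close> is one of \<open>x\<close>, but \<open>x\<close> is not a summand of \<open>y\<close>, since otherwise \<open>z\<close> would have an
  additive inverse in the pointed semigroup.
\<close>

lemma indecomposables_generate:
  fixes S :: "'a::real_vector set"
  assumes add: "\<And>x y. x \<in> S \<Longrightarrow> y \<in> S \<Longrightarrow> x + y \<in> S"
    and zero: "0 \<in> S"
    and pointed: "\<And>x y. x \<in> S \<Longrightarrow> y \<in> S \<Longrightarrow> x + y = 0 \<Longrightarrow> x = 0"
    and fin: "\<And>x. x \<in> S \<Longrightarrow> finite {y \<in> S. \<exists>z\<in>S. x = y + z}"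
  shows "generates_semigroup (indecomposables S) S"
proof -
  define D where "D x = {y \<in> S. \<exists>z\<in>S. x = y + z}" for x
  have smaller: "card (D y) < card (D (y + z))" if yz: "y \<in> S" "z \<in> S" "z \<noteq> 0" for y z
  proof -
    have "D y \<subseteq> D (y + z)"
      unfolding D_def using yz(2) by (auto simp: add.assoc intro: add)
    moreover have "y + z \<in> D (y + z)"
      unfolding D_def using yz zero by (auto intro: add bexI[of _ 0])
    moreover have "y + z \<notin> D y"
    proof
      assume "y + z \<in> D y"
      then obtain w where "w \<in> S" "y = y + z + w"
        unfolding D_def by blast
      then have "z = 0" using pointed[of z w] yz by (simp add: add.assoc)
      with yz show False by simp
    qed
    ultimately have "D y \<subset> D (y + z)" by blast
    moreover have "finite (D (y + z))"
      unfolding D_def using yz by (intro fin add)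
    ultimately show ?thesis by (rule psubset_card_mono[rotated])
  qed
  have "\<exists>F (c :: 'a \<Rightarrow> nat). finite F \<and> F \<subseteq> indecomposables S \<and> x = (\<Sum>v\<in>F. of_nat (c v) *\<^sub>R v)"
    if "x \<in> S" for x
    using that
  proof (induction "card (D x)" arbitrary: x rule: less_induct)
    case less
    consider "x = 0" | "x \<in> indecomposables S"
      | y z where "y \<in> S" "z \<in> S" "y \<noteq> 0" "z \<noteq> 0" "x = y + z"
      using less.prems unfolding indecomposables_def by blast
    then show ?case
    proof cases
      case 1
      then show ?thesis by (intro exI[of _ "{}"]) auto
    next
      case 2
      then show ?thesis by (intro exI[of _ "{x}"] exI[of _ "\<lambda>_. 1"]) auto
    next
      case 3
      have "card (D y) < card (D x)" "card (D z) < card (D x)"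
        using smaller[of y z] smaller[of z y] 3 by (auto simp: add.commute)
      then show ?thesis
        unfolding \<open>x = y + z\<close> using 3 by (intro nat_combination_add less.hyps) auto
    qed
  qed
  then show ?thesis
    unfolding generates_semigroup_def indecomposables_def by auto
qed

lemma hilbert_basis_indecomposables:
  fixes S :: "'a::real_vector set"
  assumes "\<And>x y. x \<in> S \<Longrightarrow> y \<in> S \<Longrightarrow> x + y \<in> S"
    and "0 \<in> S"
    and "\<And>x y. x \<in> S \<Longrightarrow> y \<in> S \<Longrightarrow> x + y = 0 \<Longrightarrow> x = 0"
    and "\<And>x. x \<in> S \<Longrightarrow> finite {y \<in> S. \<exists>z\<in>S. x = y + z}"
  shows "hilbert_basis (indecomposables S) S"
proof -
  have "generates_semigroup (indecomposables S) S"
    using assms by (rule indecomposables_generate)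
  moreover have "indecomposables S \<subseteq> G" if "generates_semigroup G S" for G
    using assms(2,1) that by (rule indecomposables_subset_generating)
  ultimately show ?thesis
    unfolding hilbert_basis_def minimal_generating_set_def by blast
qed

section \<open>Integer spans and lattices\<close>

lemma int_span_finite:
  assumes "finite B"
  shows "int_span B = range (\<lambda>c :: 'a \<Rightarrow> int. \<Sum>b\<in>B. of_int (c b) *\<^sub>R (b :: 'a::real_vector))"
proof (intro equalityI subsetI)
  fix x assume "x \<in> int_span B"
  then obtain F and c :: "'a \<Rightarrow> int"
    where F: "F \<subseteq> B" "x = (\<Sum>b\<in>F. of_int (c b) *\<^sub>R b)"
    unfolding int_span_def by blast
  then have "x = (\<Sum>b\<in>B. of_int (if b \<in> F then c b else 0) *\<^sub>R b)"
    using assms by (auto intro!: sum.mono_neutral_cong_left)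
  then show "x \<in> range (\<lambda>c :: 'a \<Rightarrow> int. \<Sum>b\<in>B. of_int (c b) *\<^sub>R b)"
    by (intro range_eqI[of _ _ "\<lambda>b. if b \<in> F then c b else 0"])
next
  fix x assume "x \<in> range (\<lambda>c :: 'a \<Rightarrow> int. \<Sum>b\<in>B. of_int (c b) *\<^sub>R b)"
  then show "x \<in> int_span B"
    unfolding int_span_def using assms by blast
qed

lemma int_span_base: "b \<in> B \<Longrightarrow> b \<in> int_span B"
  unfolding int_span_def by (intro CollectI exI[of _ "{b}"] exI[of _ "\<lambda>_. 1"]) auto

lemma zero_in_int_span: "0 \<in> int_span B"
  unfolding int_span_def by (intro CollectI exI[of _ "{}"]) auto

lemma int_span_diff:
  fixes B :: "'a::real_vector set"
  assumes "finite B" "x \<in> int_span B" "y \<in> int_span B"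
  shows "x - y \<in> int_span B"
proof -
  obtain c d :: "'a \<Rightarrow> int"
    where "x = (\<Sum>b\<in>B. of_int (c b) *\<^sub>R b)" "y = (\<Sum>b\<in>B. of_int (d b) *\<^sub>R b)"
    using assms by (auto simp: int_span_finite)
  then have "x - y = (\<Sum>b\<in>B. of_int (c b - d b) *\<^sub>R b)"
    by (simp add: scaleR_diff_left sum_subtractf)
  then show ?thesis
    unfolding int_span_finite[OF assms(1)] by (rule image_eqI[where x = "\<lambda>b. c b - d b"]) simp
qed

lemma int_span_add:
  assumes "finite B" "x \<in> int_span B" "y \<in> int_span B"
  shows "x + y \<in> int_span B"
  using int_span_diff[OF assms(1,2) int_span_diff[OF assms(1) zero_in_int_span assms(3)]] by simp

lemma int_span_of_int_scaleR:
  assumes "finite B" "x \<in> int_span B"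
  shows "of_int k *\<^sub>R x \<in> int_span B"
proof -
  have nonneg: "of_nat m *\<^sub>R x \<in> int_span B" for m
    using assms by (intro of_nat_scaleR_in_additive_closed int_span_add zero_in_int_span)
  show ?thesis
  proof (cases k rule: int_cases2)
    case (nonpos m)
    then show ?thesis
      using int_span_diff[OF assms(1) zero_in_int_span nonneg[of m]] by simp
  qed (use nonneg in simp)
qed

lemma int_span_minimal:
  assumes "finite B" "A \<subseteq> int_span B"
  shows "int_span A \<subseteq> int_span B"
proof
  fix x assume "x \<in> int_span A"
  then obtain F and c :: "'a \<Rightarrow> int" where "F \<subseteq> A" "x = (\<Sum>b\<in>F. of_int (c b) *\<^sub>R b)"
    unfolding int_span_def by blast
  then show "x \<in> int_span B"
    using assms
    by (auto intro!: sum_in_additive_closed int_span_add int_span_of_int_scaleR zero_in_int_span)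
qed

lemma span_int_span: "span (int_span B) = span B"
proof (rule antisym)
  have "int_span B \<subseteq> span B"
    unfolding int_span_def by (auto intro!: span_sum span_scale intro: span_base)
  then show "span (int_span B) \<subseteq> span B"
    by (rule span_minimal) simp
qed (auto intro!: span_mono int_span_base)

lemma lattice_of_full_rank:
  fixes L :: "(real^'n) set"
  assumes "lattice_of_rank CARD('n) L"
  obtains B where "independent B" "finite B" "L = int_span B" "span B = UNIV"
proof -
  obtain B where B: "independent B" "L = int_span B" "finite B" "card B = CARD('n)"
    using assms unfolding lattice_of_rank_def lattice_basis_def by blast
  have "span B = UNIV"
    using card_eq_dim[of B UNIV] B by (auto simp: dim_UNIV)
  with B that show ?thesis by blast
qed

text \<open>
  The linear functionals dual to the basis map a bounded set to bounded sets of reals, so there are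
  only finitely many choices for each integer coefficient.
\<close>

lemma finite_int_span_Int_bounded:
  fixes B :: "'a::euclidean_space set"
  assumes "independent B" "bounded S"
  shows "finite (int_span B \<inter> S)"
proof -
  have finB: "finite B"
    using assms(1) by (rule independent_imp_finite)
  have "\<exists>f. linear f \<and> (\<forall>b'\<in>B. f b' = (if b' = b then 1 else (0::real)))" for b
    using assms(1) by (rule linear_independent_extend)
  then obtain f where lin: "\<And>b. linear (f b)"
    and f: "\<And>b b'. b' \<in> B \<Longrightarrow> f b b' = (if b' = b then 1 else (0::real))"
    by metis
  define T where "T b = {k::int. of_int k \<in> f b ` S}" for b
  have finT: "finite (T b)" for b
  proof -
    have "bounded (f b ` S)"
      using assms(2) lin by (intro bounded_linear_image) (simp_all add: linear_conv_bounded_linear)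
    then obtain r where r: "\<And>y. y \<in> f b ` S \<Longrightarrow> \<bar>y\<bar> \<le> r"
      unfolding bounded_iff by auto
    have "T b \<subseteq> {- \<lceil>r\<rceil>..\<lceil>r\<rceil>}"
    proof
      fix k assume "k \<in> T b"
      then have "\<bar>of_int k\<bar> \<le> r" unfolding T_def using r by blast
      then show "k \<in> {- \<lceil>r\<rceil>..\<lceil>r\<rceil>}" by simp linarith
    qed
    then show ?thesis by (rule finite_subset) simp
  qed
  have "int_span B \<inter> S \<subseteq> (\<lambda>c. \<Sum>b\<in>B. of_int (c b) *\<^sub>R b) ` PiE B T"
  proof
    fix x assume x: "x \<in> int_span B \<inter> S"
    then obtain c :: "'a \<Rightarrow> int" where c: "x = (\<Sum>b\<in>B. of_int (c b) *\<^sub>R b)"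
      using finB by (auto simp: int_span_finite)
    have "of_int (c b) = f b x" if "b \<in> B" for b
    proof -
      have "f b x = (\<Sum>b'\<in>B. of_int (c b') * f b b')"
        unfolding c by (simp add: linear_sum[OF lin] linear_cmul[OF lin])
      also have "\<dots> = (\<Sum>b'\<in>B. if b' = b then of_int (c b') else 0)"
        by (intro sum.cong) (auto simp: f)
      finally show ?thesis using finB that by simp
    qed
    then have "restrict c B \<in> PiE B T"
      using x unfolding T_def by auto
    moreover have "x = (\<Sum>b\<in>B. of_int (restrict c B b) *\<^sub>R b)"
      unfolding c by (intro sum.cong) auto
    ultimately show "x \<in> (\<lambda>c. \<Sum>b\<in>B. of_int (c b) *\<^sub>R b) ` PiE B T" by blast
  qed
  then show ?thesis
    using finB finT by (meson finite_PiE finite_imageI finite_subset)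
qed

text \<open>Rounding down the coefficients of a vector moves it by at most the sum of the basis norms.\<close>

lemma int_span_cocompact:
  fixes B :: "'a::real_normed_vector set"
  assumes "finite B" "span B = UNIV"
  obtains R where "R \<ge> 0" "\<And>x. \<exists>y\<in>int_span B. norm (y - x) \<le> R"
proof
  show "0 \<le> (\<Sum>b\<in>B. norm b)" by (simp add: sum_nonneg)
  fix x :: 'a
  have "x \<in> span B" using assms(2) by simp
  then obtain r where r: "x = (\<Sum>b\<in>B. r b *\<^sub>R b)"
    using span_finite[OF assms(1)] by auto
  have "norm ((\<Sum>b\<in>B. of_int \<lfloor>r b\<rfloor> *\<^sub>R b) - x) = norm (\<Sum>b\<in>B. (of_int \<lfloor>r b\<rfloor> - r b) *\<^sub>R b)"
    unfolding r by (simp add: scaleR_diff_left sum_subtractf)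
  also have "\<dots> \<le> (\<Sum>b\<in>B. norm ((of_int \<lfloor>r b\<rfloor> - r b) *\<^sub>R b))"
    by (rule norm_sum)
  also have "\<dots> \<le> (\<Sum>b\<in>B. 1 * norm b)"
  proof (intro sum_mono)
    fix b
    have "\<bar>of_int \<lfloor>r b\<rfloor> - r b\<bar> \<le> 1" by linarith
    then show "norm ((of_int \<lfloor>r b\<rfloor> - r b) *\<^sub>R b) \<le> 1 * norm b"
      unfolding norm_scaleR by (intro mult_right_mono) auto
  qed
  finally show "\<exists>y\<in>int_span B. norm (y - x) \<le> (\<Sum>b\<in>B. norm b)"
    using assms(1) by (auto simp: int_span_finite)
qed

lemma coset_int_span_eq:
  assumes "finite B" "x - y \<in> int_span B"
  shows "(+) x ` int_span B = (+) y ` int_span B"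
proof -
  have sub: "(+) u ` int_span B \<subseteq> (+) v ` int_span B" if "u - v \<in> int_span B" for u v
  proof
    fix w assume "w \<in> (+) u ` int_span B"
    then obtain m where "m \<in> int_span B" "w = v + ((u - v) + m)" by auto
    then show "w \<in> (+) v ` int_span B"
      using int_span_add[OF assms(1) that] by blast
  qed
  have "y - x \<in> int_span B"
    using int_span_diff[OF assms(1) zero_in_int_span assms(2)] by simp
  with sub assms(2) show ?thesis by blast
qed

section \<open>Positive virtually rectangular lattices\<close>

text \<open>
  Take a basis vector \<open>b\<close> with nonzero \<open>i\<close>-th coordinate and suppose that its \<open>j\<close>-th coordinate is
  nonzero too. By nonnegativity and orthogonality, all other basis vectors vanish at \<open>i\<close> and \<open>j\<close>, so
  the nonzero vector supported on \<open>{i, j}\<close> and orthogonal to \<open>b\<close> is orthogonal to the whole basis.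
\<close>

lemma orthogonal_nonneg_spanning_contains_axis:
  fixes B :: "(real^'n) set"
  assumes span: "span B = UNIV" and orth: "pairwise orthogonal B"
    and nonneg: "\<And>b i. b \<in> B \<Longrightarrow> 0 \<le> b $ i"
  shows "\<exists>t>0. axis i t \<in> B"
proof -
  have "\<exists>b\<in>B. b $ i \<noteq> 0"
  proof (rule ccontr)
    assume "\<not> (\<exists>b\<in>B. b $ i \<noteq> 0)"
    then have "orthogonal (axis i 1) b" if "b \<in> B" for b
      using that by (auto simp: orthogonal_def inner_axis')
    then have "orthogonal (axis i (1::real)) (axis i 1)"
      using orthogonal_to_span[of "axis i 1" B "axis i 1"] span by simp
    then show False by (simp add: orthogonal_self)
  qed
  then obtain b where "b \<in> B" "b $ i \<noteq> 0" by blast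
  then have b: "b \<in> B" "b $ i > 0"
    using nonneg[of b i] by auto
  have "b $ j = 0" if "j \<noteq> i" for j
  proof (rule ccontr)
    assume "b $ j \<noteq> 0"
    then have bj: "b $ j > 0" using nonneg[OF b(1), of j] by simp
    have disjoint: "b' $ k = 0" if "b' \<in> B" "b' \<noteq> b" "b $ k > 0" for b' k
    proof -
      have "orthogonal b b'"
        using pairwiseD[OF orth b(1) that(1)] that(2) by simp
      then have "(\<Sum>k\<in>UNIV. b $ k * b' $ k) = 0"
        by (simp add: orthogonal_def inner_vec_def)
      moreover have "0 \<le> b $ k * b' $ k" for k
        using nonneg b(1) that(1) by simp
      ultimately have "b $ k * b' $ k = 0"
        by (simp add: sum_nonneg_eq_0_iff)
      with that show ?thesis by simp
    qed
    define w where "w = axis i (b $ j) - axis j (b $ i)"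
    have "orthogonal w b'" if "b' \<in> B" for b'
    proof (cases "b' = b")
      case True
      then show ?thesis
        by (simp add: w_def orthogonal_def inner_diff_left inner_axis')
    next
      case False
      then show ?thesis
        using disjoint[OF that False] b bj
        by (simp add: w_def orthogonal_def inner_diff_left inner_axis')
    qed
    then have "orthogonal w w"
      using orthogonal_to_span[of w B w] span by simp
    then have "w = 0" by (simp add: orthogonal_self)
    then have "w $ i = 0" by simp
    then show False using bj that by (simp add: w_def axis_def)
  qed
  then have "b = axis i (b $ i)"
    by (auto simp: vec_eq_iff axis_def)
  then show ?thesis using b by metis
qed

lemma positive_virtually_rectangular_imp_axes:
  fixes L :: "(real^'n) set"
  assumes "positive_virtually_rectangular L"
  shows "\<exists>t>0. axis i t \<in> L"
proof -
  obtain M where rank: "lattice_of_rank CARD('n) M" and "M \<subseteq> L"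
    and "\<exists>B. lattice_basis B M \<and> pairwise orthogonal B \<and> (\<forall>b\<in>B. \<forall>i. 0 \<le> b $ i)"
    using assms
    unfolding positive_virtually_rectangular_def positive_rectangular_def finite_index_def by blast
  then obtain B where B: "M = int_span B" "pairwise orthogonal B" "\<And>b i. b \<in> B \<Longrightarrow> 0 \<le> b $ i"
    unfolding lattice_basis_def by blast
  have "span B = UNIV"
    using rank B(1) span_int_span by (metis lattice_of_full_rank)
  then obtain t where "t > 0" "axis i t \<in> B"
    using orthogonal_nonneg_spanning_contains_axis B(2,3) by blast
  then show ?thesis
    using B(1) \<open>M \<subseteq> L\<close> int_span_base by blast
qed

text \<open>
  Reducing each coordinate modulo \<open>t i\<close> moves a lattice point, within its coset, to the box with
  side lengths \<open>t i\<close>.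
\<close>

lemma axes_imp_positive_virtually_rectangular:
  fixes L :: "(real^'n) set"
  assumes rank: "lattice_of_rank CARD('n) L"
    and t: "\<And>i. t i > 0" "\<And>i. axis i (t i) \<in> L"
  shows "positive_virtually_rectangular L"
proof -
  obtain C where C: "independent C" "finite C" "L = int_span C"
    using rank by (rule lattice_of_full_rank)
  define B where "B = range (\<lambda>i. axis i (t i))"
  define M where "M = int_span B"
  have finB: "finite B" by (simp add: B_def)
  have inj: "inj (\<lambda>i. axis i (t i))"
    using t(1) by (intro injI) (metis axis_eq_axis less_irrefl)
  have orth: "pairwise orthogonal B"
    by (auto simp: B_def pairwise_def orthogonal_def inner_axis_axis)
  have "0 \<notin> B"
    using t(1) by (auto simp: B_def axis_eq_0_iff) (metis less_irrefl)
  then have indep: "independent B"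
    using orth by (rule pairwise_orthogonal_independent[rotated])
  have nonneg: "\<forall>b\<in>B. \<forall>i. 0 \<le> b $ i"
    using t(1) by (auto simp: B_def axis_def less_imp_le)
  have basis: "lattice_basis B M"
    using indep by (simp add: lattice_basis_def M_def)
  moreover have "card B = CARD('n)"
    unfolding B_def using inj by (rule card_image)
  ultimately have PR: "positive_rectangular M"
    unfolding positive_rectangular_def lattice_of_rank_def using finB orth nonneg by blast
  have sub: "M \<subseteq> L"
    unfolding M_def C(3) using C(2,3) t(2) by (intro int_span_minimal) (auto simp: B_def)
  define box where "box = cbox 0 (\<chi> i. t i)"
  have "\<exists>y\<in>L \<inter> box. (+) x ` M = (+) y ` M" if "x \<in> L" for x
  proof -
    define s where "s = (\<Sum>i\<in>UNIV. of_int \<lfloor>x $ i / t i\<rfloor> *\<^sub>R axis i (t i))"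
    have "axis i (t i) \<in> int_span B" for i
      by (rule int_span_base) (simp add: B_def)
    then have s: "s \<in> M"
      unfolding s_def M_def using finB
      by (intro sum_in_additive_closed int_span_add int_span_of_int_scaleR zero_in_int_span)
    have coord: "s $ i = of_int \<lfloor>x $ i / t i\<rfloor> * t i" for i
      by (simp add: s_def axis_def if_distrib[of "\<lambda>r. _ * r"] cong: if_cong)
    have "0 \<le> x $ i - s $ i \<and> x $ i - s $ i \<le> t i" for i
    proof -
      have "of_int \<lfloor>x $ i / t i\<rfloor> * t i \<le> x $ i" "x $ i \<le> (of_int \<lfloor>x $ i / t i\<rfloor> + 1) * t i"
        using t(1)[of i] by (simp_all flip: pos_le_divide_eq pos_divide_le_eq)
      then show ?thesis
        by (simp add: coord distrib_right)
    qed
    then have "x - s \<in> box"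
      by (simp add: box_def mem_box_cart)
    moreover have "x - s \<in> L"
      using that s sub C int_span_diff by blast
    moreover have "(+) x ` M = (+) (x - s) ` M"
      unfolding M_def using finB s by (intro coset_int_span_eq) (simp_all add: M_def)
    ultimately show ?thesis by blast
  qed
  then have "(\<lambda>x. (+) x ` M) ` L \<subseteq> (\<lambda>x. (+) x ` M) ` (L \<inter> box)"
    by blast
  moreover have "finite (L \<inter> box)"
    unfolding C(3) box_def using C(1) by (intro finite_int_span_Int_bounded) auto
  ultimately have "finite_index M L"
    unfolding finite_index_def using sub by (meson finite_imageI finite_subset)
  with PR show ?thesis
    unfolding positive_virtually_rectangular_def by blast
qed

section \<open>The nonnegative part of a lattice\<close>

lemma hilbert_basis_nonneg_part:
  fixes L :: "(real^'n) set"
  assumes "lattice_of_rank CARD('n) L"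
  shows "hilbert_basis (indecomposables (nonneg_part L)) (nonneg_part L)"
proof (rule hilbert_basis_indecomposables)
  obtain B where B: "independent B" "finite B" "L = int_span B"
    using assms by (rule lattice_of_full_rank)
  show "0 \<in> nonneg_part L"
    by (simp add: nonneg_part_def B zero_in_int_span)
  fix x y assume x: "x \<in> nonneg_part L"
  {
    assume y: "y \<in> nonneg_part L"
    then show "x + y \<in> nonneg_part L"
      using x B by (simp add: nonneg_part_def int_span_add)
    assume "x + y = 0"
    then have "x $ i + y $ i = 0" for i
      by (metis vector_add_component zero_index)
    then show "x = 0"
      using x y unfolding nonneg_part_def vec_eq_iff
      by (simp add: add_nonneg_eq_0_iff)
  }
  have "{y \<in> nonneg_part L. \<exists>z\<in>nonneg_part L. x = y + z} \<subseteq> int_span B \<inter> cbox 0 x"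
    by (auto simp: nonneg_part_def B mem_box_cart)
  moreover have "finite (int_span B \<inter> cbox 0 x)"
    using B(1) by (intro finite_int_span_Int_bounded) auto
  ultimately show "finite {y \<in> nonneg_part L. \<exists>z\<in>nonneg_part L. x = y + z}"
    by (rule finite_subset)
qed

lemma finite_indecomposables_if_axes:
  fixes L :: "(real^'n) set"
  assumes rank: "lattice_of_rank CARD('n) L"
    and t: "\<And>i. t i > 0" "\<And>i. axis i (t i) \<in> L"
  shows "finite (indecomposables (nonneg_part L))"
proof -
  obtain B where B: "independent B" "finite B" "L = int_span B"
    using rank by (rule lattice_of_full_rank)
  have "x $ i \<le> t i" if x: "x \<in> indecomposables (nonneg_part L)" for x i
  proof (rule ccontr)
    assume gt: "\<not> x $ i \<le> t i"
    define a where "a = axis i (t i)"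
    have xL: "x \<in> L" "\<And>k. 0 \<le> x $ k"
      using x by (auto simp: indecomposables_def nonneg_part_def)
    have a: "a \<in> nonneg_part L" "a $ i = t i"
      using t by (auto simp: a_def nonneg_part_def axis_def less_imp_le)
    have "x - a \<in> L"
      using xL a B by (simp add: nonneg_part_def int_span_diff)
    moreover have "0 \<le> (x - a) $ k" for k
      using xL gt by (cases "k = i") (auto simp: a_def axis_def)
    ultimately have "x - a \<in> nonneg_part L"
      by (simp add: nonneg_part_def)
    moreover have "a \<noteq> 0" "x - a \<noteq> 0"
      using t(1)[of i] gt a(2) by auto
    moreover have "x = a + (x - a)" by simp
    ultimately show False
      using x a(1) unfolding indecomposables_def by blast
  qed
  then have "indecomposables (nonneg_part L) \<subseteq> int_span B \<inter> cbox 0 (\<chi> i. t i)"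
    by (auto simp: mem_box_cart B indecomposables_def nonneg_part_def)
  moreover have "finite (int_span B \<inter> cbox 0 (\<chi> i. t i))"
    using B(1) by (intro finite_int_span_Int_bounded) auto
  ultimately show ?thesis by (rule finite_subset)
qed

text \<open>
  If no generator lies on the \<open>i\<close>-th axis, then \<open>x $ i \<le> K * (\<Sum>k\<in>-{i}. x $ k)\<close> holds with a common
  constant \<open>K\<close> for all generators, hence for the semigroup that they generate. A lattice point close
  to the \<open>i\<close>-th axis and far from the origin violates this inequality.
\<close>

lemma finite_generating_contains_axis:
  fixes L :: "(real^'n) set"
  assumes rank: "lattice_of_rank CARD('n) L"
    and gen: "generates_semigroup G (nonneg_part L)" and fin: "finite G"
  shows "\<exists>t>0. axis i t \<in> G"
proof (rule ccontr)
  assume no_axis: "\<not> (\<exists>t>0. axis i t \<in> G)"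
  obtain B where B: "finite B" "L = int_span B" "span B = UNIV"
    using rank by (rule lattice_of_full_rank)
  define f :: "real^'n \<Rightarrow> real" where "f x = (\<Sum>k\<in>-{i}. x $ k)" for x
  have f_nonneg: "0 \<le> f v" if "\<And>k. 0 \<le> v $ k" for v
    unfolding f_def using that by (intro sum_nonneg) auto
  have nonneg: "0 \<le> v $ k" if "v \<in> G" for v k
    using gen that by (auto simp: generates_semigroup_def nonneg_part_def)
  define K where "K = (\<Sum>v\<in>G. v $ i / f v)"
  have term_nonneg: "0 \<le> v $ i / f v" if "v \<in> G" for v
    using nonneg[OF that] f_nonneg by simp
  have "0 \<le> K"
    unfolding K_def using term_nonneg by (rule sum_nonneg)
  have gen_bound: "v $ i \<le> K * f v" if v: "v \<in> G" for v
  proof (cases "f v = 0")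
    case True
    then have zero: "v $ k = 0" if "k \<noteq> i" for k
      using nonneg[OF v] that unfolding f_def by (subst (asm) sum_nonneg_eq_0_iff) auto
    then have "v = axis i (v $ i)"
      by (auto simp: vec_eq_iff axis_def)
    then have "\<not> v $ i > 0"
      using no_axis v by metis
    with True show ?thesis by simp
  next
    case False
    then have "f v > 0" using f_nonneg nonneg[OF v] by (simp add: less_le)
    moreover have "v $ i / f v \<le> K"
      unfolding K_def using v fin term_nonneg by (intro member_le_sum) auto
    ultimately show ?thesis by (simp add: divide_le_eq)
  qed
  have bound: "x $ i \<le> K * f x" if x: "x \<in> nonneg_part L" for x
  proof -
    obtain F and c :: "real^'n \<Rightarrow> nat"
      where F: "F \<subseteq> G" "x = (\<Sum>v\<in>F. of_nat (c v) *\<^sub>R v)"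
      using gen x unfolding generates_semigroup_def by blast
    have "x $ i = (\<Sum>v\<in>F. of_nat (c v) * v $ i)"
      unfolding F(2) by simp
    also have "\<dots> \<le> (\<Sum>v\<in>F. of_nat (c v) * (K * f v))"
      using F(1) gen_bound by (intro sum_mono mult_left_mono) auto
    also have "\<dots> = K * (\<Sum>v\<in>F. of_nat (c v) * f v)"
      by (simp add: sum_distrib_left mult_ac)
    also have "(\<Sum>v\<in>F. of_nat (c v) * f v) = f x"
      unfolding F(2) f_def by (simp add: sum_distrib_left sum.swap[of _ F])
    finally show ?thesis .
  qed
  obtain R where R: "R \<ge> 0" "\<And>x. \<exists>y\<in>int_span B. norm (y - x) \<le> R"
    using B(1,3) int_span_cocompact by blast
  define m where "m = real (card (-{i}))"
  \<comment> \<open>The center of the ball is shifted by \<open>R\<close> in every direction, so that the whole ball lies in the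
    nonnegative orthant; the summand \<open>K * (m * (2 * R)) + 1\<close> beats the bound that \<open>K\<close> allows.\<close>
  define p :: "real^'n" where "p = (\<chi> k. R) + axis i (K * (m * (2 * R)) + 1)"
  obtain y where y: "y \<in> L" "norm (y - p) \<le> R"
    using R B(2) by blast
  have near: "\<bar>y $ k - p $ k\<bar> \<le> R" for k
    using component_le_norm_cart[of "y - p" k] y(2) by simp
  have pi: "p $ i = R + (K * (m * (2 * R)) + 1)" and pk: "\<And>k. k \<noteq> i \<Longrightarrow> p $ k = R"
    by (auto simp: p_def axis_def)
  have "0 \<le> K * (m * (2 * R))"
    using \<open>0 \<le> K\<close> R(1) by (simp add: m_def)
  then have "0 \<le> y $ i"
    using near[of i] pi by linarith
  moreover have "0 \<le> y $ k" if "k \<noteq> i" for k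
    using near[of k] pk[OF that] by linarith
  ultimately have "0 \<le> y $ k" for k by metis
  then have "y $ i \<le> K * f y"
    using y(1) by (intro bound) (simp add: nonneg_part_def)
  also have "f y \<le> m * (2 * R)"
  proof -
    have "f y \<le> (\<Sum>k\<in>-{i}. 2 * R)"
      unfolding f_def
    proof (rule sum_mono)
      fix k assume "k \<in> -{i}"
      then show "y $ k \<le> 2 * R" using near[of k] pk[of k] by auto
    qed
    then show ?thesis by (simp add: m_def)
  qed
  then have "K * f y \<le> K * (m * (2 * R))"
    using \<open>0 \<le> K\<close> by (rule mult_left_mono)
  finally show False
    using near[of i] pi by linarith
qed

theorem corollary2p5:
  fixes L :: "(real^'n) set"
  assumes "CARD('n) \<ge> 2"
    and "lattice_of_rank CARD('n) L"
  shows "hilbert_basis (indecomposables (nonneg_part L)) (nonneg_part L) \<and>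
    (positive_virtually_rectangular L \<longrightarrow> finite (indecomposables (nonneg_part L))) \<and>
    (\<not> positive_virtually_rectangular L \<longrightarrow> infinite (indecomposables (nonneg_part L)))"
proof (intro conjI impI notI)
  show basis: "hilbert_basis (indecomposables (nonneg_part L)) (nonneg_part L)"
    using assms(2) by (rule hilbert_basis_nonneg_part)
  show "finite (indecomposables (nonneg_part L))" if PVR: "positive_virtually_rectangular L"
  proof -
    obtain t where "\<And>i. t i > 0" "\<And>i. axis i (t i) \<in> L"
      using positive_virtually_rectangular_imp_axes[OF PVR] by metis
    with assms(2) show ?thesis by (rule finite_indecomposables_if_axes)
  qed
  assume not_PVR: "\<not> positive_virtually_rectangular L"
    and fin: "finite (indecomposables (nonneg_part L))"
  have gen: "generates_semigroup (indecomposables (nonneg_part L)) (nonneg_part L)"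
    using basis unfolding hilbert_basis_def minimal_generating_set_def by blast
  have "indecomposables (nonneg_part L) \<subseteq> L"
    by (auto simp: indecomposables_def nonneg_part_def)
  then have "\<exists>t>0. axis i t \<in> L" for i
    using finite_generating_contains_axis[OF assms(2) gen fin, of i] by blast
  then obtain t where "\<And>i. t i > 0" "\<And>i. axis i (t i) \<in> L"
    by metis
  then show False
    using axes_imp_positive_virtually_rectangular assms(2) not_PVR by blast
qed

end
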